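(* For every $n\geq 3$, Player 1 has a winning strategy for $\texttt{RAV}(D_n,\{r,s\})$, where $D_n=\langle r,s\mid r^n=s^2=rsrs=e\rangle$ is the dihedral group of order $2n$.
   Context: Game $\texttt{RAV}(G,S)$: $G$ is a finite group and $S$ a generating set with $e\notin S$. Two players alternate turns, Player 1 first, starting from the empty word $w_0$. On turn $n$ the current player chooses $s_n\in S\cup S^{-1}$, subject to $s_n\neq s_{n-1}^{-1}$ when $n>1$, and forms $w_n=w_{n-1}s_n$. If $w_n$ represents the same element of $G$ as some $w_k$ with $0\le k<n$, the player who formed $w_n$ loses. If a player has no legal move, that player loses. *)

theory Defs
  imports "HOL-Algebra.Generated_Groups"
begin

section \<open>The game RAV\<close>

text \<open>
  A position is the list \<open>[s\<^sub>1, \<dots>, s\<^sub>n]\<close> of all moves made so far, in the order in which they were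
  made. The moves are elements of the group, so an involution and its inverse are one and the
  same move.
\<close>

datatype player = Player1 | Player2

definition to_move :: "'a list \<Rightarrow> player" where
  "to_move w = (if even (length w) then Player1 else Player2)"

definition word_val :: "('a, 'b) monoid_scheme \<Rightarrow> 'a list \<Rightarrow> 'a" where
  "word_val G w = foldl (\<lambda>g x. g \<otimes>\<^bsub>G\<^esub> x) \<one>\<^bsub>G\<^esub> w"

definition legal_move :: "('a, 'b) monoid_scheme \<Rightarrow> 'a set \<Rightarrow> 'a list \<Rightarrow> 'a \<Rightarrow> bool" where
  "legal_move G S w x \<longleftrightarrow>
     x \<in> S \<union> (set_inv\<^bsub>G\<^esub> S) \<and> (w \<noteq> [] \<longrightarrow> x \<noteq> inv\<^bsub>G\<^esub> (last w))"

definition revisits :: "('a, 'b) monoid_scheme \<Rightarrow> 'a list \<Rightarrow> bool" where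
  "revisits G w \<longleftrightarrow> (\<exists>k<length w. word_val G w = word_val G (take k w))"

definition game_over :: "('a, 'b) monoid_scheme \<Rightarrow> 'a set \<Rightarrow> 'a list \<Rightarrow> bool" where
  "game_over G S w \<longleftrightarrow> revisits G w \<or> \<not> (\<exists>x. legal_move G S w x)"

inductive position :: "('a, 'b) monoid_scheme \<Rightarrow> 'a set \<Rightarrow> 'a list \<Rightarrow> bool"
  for G S where
  start: "position G S []"
| move: "position G S (w @ [x])"
    if "position G S w" "\<not> game_over G S w" "legal_move G S w x"

text \<open>
  The loser at a position where the game is over: after a revisit it is the player who made the
  last move, i.e. the one who is not to move; otherwise it is the player to move, who is stuck.
\<close>

definition loses :: "('a, 'b) monoid_scheme \<Rightarrow> player \<Rightarrow> 'a list \<Rightarrow> bool" where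
  "loses G p w \<longleftrightarrow> (if revisits G w then to_move w \<noteq> p else to_move w = p)"

definition follows :: "player \<Rightarrow> ('a list \<Rightarrow> 'a) \<Rightarrow> 'a list \<Rightarrow> bool" where
  "follows p \<sigma> w \<longleftrightarrow>
     (\<forall>i<length w. to_move (take i w) = p \<longrightarrow> w ! i = \<sigma> (take i w))"

text \<open>
  At every position that can arise while \<open>p\<close> follows \<open>\<sigma>\<close>, the strategy must prescribe a legal move
  whenever \<open>p\<close> has to move, and \<open>p\<close> must not be the loser if the game is over. Nothing needs to
  be said about infinite plays: over a finite group there are none, see \<open>position_length_le\<close>.
\<close>

definition winning_strategy ::
  "('a, 'b) monoid_scheme \<Rightarrow> 'a set \<Rightarrow> player \<Rightarrow> ('a list \<Rightarrow> 'a) \<Rightarrow> bool" where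
  "winning_strategy G S p \<sigma> \<longleftrightarrow>
     (\<forall>w. position G S w \<and> follows p \<sigma> w \<longrightarrow>
        (if game_over G S w then \<not> loses G p w
         else to_move w = p \<longrightarrow> legal_move G S w (\<sigma> w)))"

definition has_winning_strategy ::
  "('a, 'b) monoid_scheme \<Rightarrow> 'a set \<Rightarrow> player \<Rightarrow> bool" where
  "has_winning_strategy G S p \<longleftrightarrow> (\<exists>\<sigma>. winning_strategy G S p \<sigma>)"

text \<open>The standing assumptions on \<open>G\<close> and \<open>S\<close>.\<close>

locale rav_game = group G for G (structure) +
  fixes S :: "'a set"
  assumes finite_carrier: "finite (carrier G)"
    and S_subset: "S \<subseteq> carrier G"
    and S_generates: "generate G S = carrier G"
    and one_notin_S: "\<one> \<notin> S"
begin

lemma word_val_closed: "set w \<subseteq> carrier G \<Longrightarrow> word_val G w \<in> carrier G"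
  by (induction w rule: rev_induct) (auto simp: word_val_def)

lemma position_closed: "position G S w \<Longrightarrow> set w \<subseteq> carrier G"
  by (induction rule: position.induct) (use S_subset in \<open>auto simp: legal_move_def SET_INV_def\<close>)

lemma position_inj:
  "position G S w \<Longrightarrow> inj_on (\<lambda>k. word_val G (take k w)) {..<length w}"
proof (induction rule: position.induct)
  case start
  show ?case by simp
next
  case (move w x)
  have eq: "inj_on (\<lambda>k. word_val G (take k (w @ [x]))) {..<length w}"
    using move.IH by (rule inj_on_cong [THEN iffD1, rotated]) auto
  have "word_val G w \<noteq> word_val G (take k w)" if "k < length w" for k
    using move.hyps(2) that by (auto simp: game_over_def revisits_def)
  then have "word_val G w \<notin> (\<lambda>k. word_val G (take k (w @ [x]))) ` {..<length w}"
    by auto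
  then show ?case
    using eq by (simp add: lessThan_Suc)
qed

lemma position_length_le:
  assumes "position G S w"
  shows "length w \<le> card (carrier G)"
proof -
  have "(\<lambda>k. word_val G (take k w)) ` {..<length w} \<subseteq> carrier G"
    using position_closed[OF assms] by (auto intro!: word_val_closed dest: in_set_takeD)
  from card_inj_on_le[OF position_inj[OF assms] this finite_carrier] show ?thesis
    by simp
qed

end


section \<open>Groups given by generators and relators\<close>

text \<open>
  In a word, the letter \<open>(x, True)\<close> stands for the generator \<open>x\<close> and \<open>(x, False)\<close> for its formal
  inverse. The generators are all elements of the type \<open>'g\<close>.
\<close>

type_synonym 'g word = "('g \<times> bool) list"

inductive pres_cong :: "'g word set \<Rightarrow> 'g word \<Rightarrow> 'g word \<Rightarrow> bool"
  for R where
  refl: "pres_cong R u u"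
| sym: "pres_cong R u v \<Longrightarrow> pres_cong R v u"
| trans: "pres_cong R u v \<Longrightarrow> pres_cong R v w \<Longrightarrow> pres_cong R u w"
| cancel: "pres_cong R (u @ [(x, b), (x, \<not> b)] @ v) (u @ v)"
| relator: "q \<in> R \<Longrightarrow> pres_cong R (u @ q @ v) (u @ v)"

declare pres_cong.trans [trans]

definition pres_rel :: "'g word set \<Rightarrow> ('g word \<times> 'g word) set" where
  "pres_rel R = {(u, v). pres_cong R u v}"

definition pres_class :: "'g word set \<Rightarrow> 'g word \<Rightarrow> 'g word set" where
  "pres_class R u = pres_rel R `` {u}"

definition presented_group :: "'g word set \<Rightarrow> 'g word set monoid" where
  "presented_group R =
     \<lparr>carrier = UNIV // pres_rel R,
      monoid.mult = (\<lambda>A B. \<Union>a\<in>A. \<Union>b\<in>B. pres_class R (a @ b)),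
      one = pres_class R []\<rparr>"

lemma equiv_pres_rel: "equiv UNIV (pres_rel R)"
proof (rule equivI)
  show "refl (pres_rel R)" by (simp add: refl_on_def pres_rel_def pres_cong.refl)
  show "sym (pres_rel R)"
    by (rule symI) (unfold pres_rel_def mem_Collect_eq case_prod_conv, rule pres_cong.sym)
  show "trans (pres_rel R)"
    by (rule transI) (unfold pres_rel_def mem_Collect_eq case_prod_conv, rule pres_cong.trans)
qed simp

lemma pres_class_eq_iff: "pres_class R u = pres_class R v \<longleftrightarrow> pres_cong R u v"
proof -
  have "pres_class R u = pres_class R v \<longleftrightarrow> (u, v) \<in> pres_rel R"
    unfolding pres_class_def by (rule eq_equiv_class_iff[OF equiv_pres_rel UNIV_I UNIV_I])
  then show ?thesis by (simp add: pres_rel_def)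
qed

lemma pres_cong_append1: "pres_cong R u v \<Longrightarrow> pres_cong R (a @ u @ b) (a @ v @ b)"
proof (induction rule: pres_cong.induct)
  case (cancel u x c v)
  show ?case using pres_cong.cancel[of R "a @ u" x c "v @ b"] by simp
next
  case (relator q u v)
  then show ?case using pres_cong.relator[of q R "a @ u" "v @ b"] by simp
next
  case (trans u v w)
  show ?case by (rule pres_cong.trans[OF trans.IH])
next
  case (sym u v)
  show ?case by (rule pres_cong.sym[OF sym.IH])
qed (rule pres_cong.refl)

lemma pres_cong_append:
  assumes "pres_cong R u u'" "pres_cong R v v'"
  shows "pres_cong R (u @ v) (u' @ v')"
  using pres_cong_append1[OF assms(1), of "[]" v] pres_cong_append1[OF assms(2), of u' "[]"]
  by simp (rule pres_cong.trans)

lemma carrier_presented_group: "carrier (presented_group R) = range (pres_class R)"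
  by (auto simp: presented_group_def pres_class_def quotient_def)

lemma one_presented_group: "\<one>\<^bsub>presented_group R\<^esub> = pres_class R []"
  by (simp add: presented_group_def)

lemma mult_presented_group:
  "pres_class R u \<otimes>\<^bsub>presented_group R\<^esub> pres_class R v = pres_class R (u @ v)"
proof -
  have eq: "pres_class R (a @ b) = pres_class R (u @ v)"
    if "a \<in> pres_class R u" "b \<in> pres_class R v" for a b
  proof -
    have "pres_cong R u a" "pres_cong R v b"
      using that by (simp_all add: pres_class_def pres_rel_def)
    from pres_cong_append[OF this] show ?thesis
      unfolding pres_class_eq_iff by (rule pres_cong.sym)
  qed
  have "u \<in> pres_class R u" "v \<in> pres_class R v"
    by (simp_all add: pres_class_def pres_rel_def pres_cong.refl)
  then have "(\<Union>a\<in>pres_class R u. \<Union>b\<in>pres_class R v. pres_class R (a @ b)) = pres_class R (u @ v)"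
    using eq by blast
  then show ?thesis
    by (simp add: presented_group_def)
qed

definition word_inv :: "'g word \<Rightarrow> 'g word" where
  "word_inv u = rev (map (\<lambda>(x, b). (x, \<not> b)) u)"

lemma pres_cong_word_inv: "pres_cong R (word_inv u @ u) []"
proof (induction u)
  case Nil
  show ?case by (simp add: word_inv_def pres_cong.refl)
next
  case (Cons a u)
  obtain x b where a: "a = (x, b)" by force
  have "pres_cong R (word_inv u @ [(x, \<not> b), (x, \<not> \<not> b)] @ u) (word_inv u @ u)"
    by (rule pres_cong.cancel)
  from pres_cong.trans[OF this Cons.IH] show ?case
    by (simp add: a word_inv_def)
qed

lemma pres_class_closed: "pres_class R u \<in> carrier (presented_group R)"
  by (simp add: carrier_presented_group)

lemma mult_word_inv:
  "pres_class R (word_inv u) \<otimes>\<^bsub>presented_group R\<^esub> pres_class R u = \<one>\<^bsub>presented_group R\<^esub>"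
  unfolding mult_presented_group one_presented_group pres_class_eq_iff
  by (rule pres_cong_word_inv)

lemma group_presented_group: "group (presented_group R)"
proof (rule groupI, unfold carrier_presented_group)
  show "\<one>\<^bsub>presented_group R\<^esub> \<in> range (pres_class R)"
    by (simp add: one_presented_group)
next
  fix x y assume "x \<in> range (pres_class R)" "y \<in> range (pres_class R)"
  then obtain u v where "x = pres_class R u" "y = pres_class R v" by blast
  then show "x \<otimes>\<^bsub>presented_group R\<^esub> y \<in> range (pres_class R)"
    by (simp add: mult_presented_group)
next
  fix x y z
  assume "x \<in> range (pres_class R)" "y \<in> range (pres_class R)" "z \<in> range (pres_class R)"
  then obtain u v w where "x = pres_class R u" "y = pres_class R v" "z = pres_class R w"
    by blast
  then show "x \<otimes>\<^bsub>presented_group R\<^esub> y \<otimes>\<^bsub>presented_group R\<^esub> z =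
      x \<otimes>\<^bsub>presented_group R\<^esub> (y \<otimes>\<^bsub>presented_group R\<^esub> z)"
    by (simp add: mult_presented_group)
next
  fix x assume "x \<in> range (pres_class R)"
  then obtain u where u: "x = pres_class R u" by blast
  show "\<one>\<^bsub>presented_group R\<^esub> \<otimes>\<^bsub>presented_group R\<^esub> x = x"
    by (simp add: one_presented_group mult_presented_group u)
  show "\<exists>y\<in>range (pres_class R). y \<otimes>\<^bsub>presented_group R\<^esub> x = \<one>\<^bsub>presented_group R\<^esub>"
    unfolding u by (rule bexI, rule mult_word_inv, rule rangeI)
qed

lemma inv_presented_group:
  "inv\<^bsub>presented_group R\<^esub> pres_class R u = pres_class R (word_inv u)"
  by (rule group.inv_equality[OF group_presented_group mult_word_inv])
     (rule pres_class_closed)+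


section \<open>The dihedral group\<close>

datatype dihedral_gen = Rot | Refl

definition dihedral_relators :: "nat \<Rightarrow> dihedral_gen word set" where
  "dihedral_relators n =
     {replicate n (Rot, True),
      [(Refl, True), (Refl, True)],
      [(Rot, True), (Refl, True), (Rot, True), (Refl, True)]}"

definition dihedral :: "nat \<Rightarrow> dihedral_gen word set monoid" where
  "dihedral n = presented_group (dihedral_relators n)"

definition rotation :: "nat \<Rightarrow> dihedral_gen word set" where
  "rotation n = pres_class (dihedral_relators n) [(Rot, True)]"

definition reflection :: "nat \<Rightarrow> dihedral_gen word set" where
  "reflection n = pres_class (dihedral_relators n) [(Refl, True)]"

text \<open>
  The pair \<open>(k, b)\<close> stands for the element \<open>r\<^sup>k\<close>, multiplied by \<open>s\<close> on the right if \<open>b\<close> holds;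
  \<open>dih_step\<close> is right multiplication by a letter.
\<close>

fun dih_step :: "nat \<Rightarrow> dihedral_gen \<times> bool \<Rightarrow> int \<times> bool \<Rightarrow> int \<times> bool" where
  "dih_step n (Rot, c) (k, b) = ((if b = c then k - 1 else k + 1) mod int n, b)"
| "dih_step n (Refl, c) (k, b) = (k, \<not> b)"

definition dih_nf :: "nat \<Rightarrow> dihedral_gen word \<Rightarrow> int \<times> bool" where
  "dih_nf n u = fold (dih_step n) u (0, False)"

definition dih_word :: "int \<times> bool \<Rightarrow> dihedral_gen word" where
  "dih_word p = replicate (nat (fst p)) (Rot, True) @ (if snd p then [(Refl, True)] else [])"

context
  fixes n :: nat
  assumes n: "n \<ge> 1"
begin

lemma fold_dih_step_range:
  "p \<in> {0..<int n} \<times> UNIV \<Longrightarrow> fold (dih_step n) u p \<in> {0..<int n} \<times> UNIV"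
proof (induction u arbitrary: p)
  case (Cons a u)
  have "dih_step n a p \<in> {0..<int n} \<times> UNIV"
    using Cons.prems n by (cases "(n, a, p)" rule: dih_step.cases) auto
  then show ?case using Cons.IH by simp
qed simp

lemma fold_dih_step_Rot:
  "k \<in> {0..<int n} \<Longrightarrow>
    fold (dih_step n) (replicate m (Rot, True)) (k, b) =
    ((if b then k - int m else k + int m) mod int n, b)"
proof (induction m)
  case (Suc m)
  have "replicate (Suc m) (Rot, True) = replicate m (Rot, True) @ [(Rot, True)]"
    by (simp add: replicate_append_same)
  then show ?case
    using Suc by (auto simp: mod_simps algebra_simps)
qed auto

lemma fold_dih_step_cong:
  "pres_cong (dihedral_relators n) u v \<Longrightarrow> p \<in> {0..<int n} \<times> UNIV \<Longrightarrow>
    fold (dih_step n) u p = fold (dih_step n) v p"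
proof (induction arbitrary: p rule: pres_cong.induct)
  case (cancel u x c v)
  obtain k b where kb: "fold (dih_step n) u p = (k, b)" "k \<in> {0..<int n}"
    using fold_dih_step_range[OF cancel] by fastforce
  show ?case
    using kb by (cases x; cases c; cases b) (auto simp: mod_simps)
next
  case (relator q u v)
  obtain k b where kb: "fold (dih_step n) u p = (k, b)" "k \<in> {0..<int n}"
    using fold_dih_step_range[OF relator(2)] by fastforce
  have "fold (dih_step n) q (k, b) = (k, b)"
    using relator(1) kb(2) unfolding dihedral_relators_def
    by (elim insertE; cases b) (auto simp: fold_dih_step_Rot mod_simps simp del: fold_replicate)
  then show ?case
    using kb by simp
qed auto

lemma dih_nf_word:
  assumes "p \<in> {0..<int n} \<times> UNIV"
  shows "dih_nf n (dih_word p) = p"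
  using assms n by (cases p) (auto simp: dih_nf_def dih_word_def fold_dih_step_Rot simp del: fold_replicate)

end

context
  fixes n :: nat
  assumes n: "n \<ge> 1"
begin

private abbreviation cong (infix "\<approx>" 50) where
  "u \<approx> v \<equiv> pres_cong (dihedral_relators n) u v"

private abbreviation rs :: "nat \<Rightarrow> dihedral_gen word" where
  "rs k \<equiv> replicate k (Rot, True)"

private lemma relators_cong:
  "rs n \<approx> []"
  "[(Refl, True), (Refl, True)] \<approx> []"
  "[(Rot, True), (Refl, True), (Rot, True), (Refl, True)] \<approx> []"
  using pres_cong.relator[of _ "dihedral_relators n" "[]" "[]"]
  by (simp_all add: dihedral_relators_def)

private lemma cancel_cong: "[(x, b), (x, \<not> b)] \<approx> []"
  using pres_cong.cancel[of _ "[]" x b "[]"] by simp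

private lemma Rot_inv_cong: "[(Rot, False)] \<approx> rs (n - 1)"
proof -
  have rs_n: "rs n = rs (n - 1) @ [(Rot, True)]"
    using n by (cases n) (auto simp: replicate_append_same)
  have 1: "rs n @ [(Rot, False)] \<approx> [] @ [(Rot, False)]"
    by (rule pres_cong_append[OF relators_cong(1) pres_cong.refl])
  have 2: "rs (n - 1) @ [(Rot, True), (Rot, False)] \<approx> rs (n - 1) @ []"
    using cancel_cong[of Rot True] by (intro pres_cong_append pres_cong.refl) simp
  have "[(Rot, False)] \<approx> rs (n - 1) @ [(Rot, True), (Rot, False)]"
    using pres_cong.sym[OF 1] by (simp add: rs_n)
  also have "\<dots> \<approx> rs (n - 1)"
    using 2 by simp
  finally show ?thesis .
qed

private lemma Refl_inv_cong: "[(Refl, c)] \<approx> [(Refl, True)]"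
proof (cases c)
  case False
  have 1: "[(Refl, True), (Refl, True)] @ [(Refl, False)] \<approx> [] @ [(Refl, False)]"
    by (rule pres_cong_append[OF relators_cong(2) pres_cong.refl])
  have 2: "[(Refl, True)] @ [(Refl, True), (Refl, False)] \<approx> [(Refl, True)] @ []"
    using cancel_cong[of Refl True] by (intro pres_cong_append pres_cong.refl) simp
  have "[(Refl, False)] \<approx> [(Refl, True), (Refl, True), (Refl, False)]"
    using pres_cong.sym[OF 1] by simp
  also have "\<dots> \<approx> [(Refl, True)]"
    using 2 by simp
  finally show ?thesis
    using False by simp
qed (simp add: pres_cong.refl)

private lemma Refl_Rot_cong: "[(Refl, True), (Rot, True)] \<approx> rs (n - 1) @ [(Refl, True)]"
proof -
  let ?R = "(Rot, True)" and ?R' = "(Rot, False)" and ?S = "(Refl, True)"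
  have 1: "[?R', ?R] @ [?S, ?R] \<approx> [] @ [?S, ?R]"
    using cancel_cong[of Rot False] by (intro pres_cong_append pres_cong.refl) simp
  have 2: "[?R', ?R, ?S, ?R] @ [?S, ?S] \<approx> [?R', ?R, ?S, ?R] @ []"
    by (intro pres_cong_append pres_cong.refl relators_cong)
  have 3: "[?R'] @ [?R, ?S, ?R, ?S] @ [?S] \<approx> [?R'] @ [] @ [?S]"
    by (intro pres_cong_append1 relators_cong)
  have 4: "[?R'] @ [?S] \<approx> rs (n - 1) @ [?S]"
    by (intro pres_cong_append Rot_inv_cong pres_cong.refl)
  have "[?S, ?R] \<approx> [?R', ?R, ?S, ?R]"
    using pres_cong.sym[OF 1] by simp
  also have "\<dots> \<approx> [?R', ?R, ?S, ?R, ?S, ?S]"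
    using pres_cong.sym[OF 2] by simp
  also have "\<dots> \<approx> [?R', ?S]" using 3 by simp
  also have "\<dots> \<approx> rs (n - 1) @ [?S]" using 4 by simp
  finally show ?thesis .
qed

private lemma Refl_rs_cong: "[(Refl, True)] @ rs m \<approx> rs (m * (n - 1)) @ [(Refl, True)]"
proof (induction m)
  case (Suc m)
  have "[(Refl, True)] @ rs (Suc m) = [] @ [(Refl, True), (Rot, True)] @ rs m" by simp
  also have "\<dots> \<approx> [] @ (rs (n - 1) @ [(Refl, True)]) @ rs m"
    by (intro pres_cong_append1 Refl_Rot_cong)
  also have "\<dots> = rs (n - 1) @ ([(Refl, True)] @ rs m)" by simp
  also have "\<dots> \<approx> rs (n - 1) @ (rs (m * (n - 1)) @ [(Refl, True)])"
    by (intro pres_cong_append pres_cong.refl Suc.IH)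
  also have "\<dots> = rs (Suc m * (n - 1)) @ [(Refl, True)]"
    by (simp add: replicate_add)
  finally show ?case .
qed (simp add: pres_cong.refl)

private lemma rs_mod_cong: "rs k \<approx> rs (k mod n)"
proof (induction k rule: less_induct)
  case (less k)
  show ?case
  proof (cases "k < n")
    case False
    have "rs n @ rs (k - n) \<approx> [] @ rs ((k - n) mod n)"
      using False n by (intro pres_cong_append relators_cong less.IH) auto
    moreover have "rs n @ rs (k - n) = rs k"
      using False by (simp flip: replicate_add)
    ultimately show ?thesis using False by (simp add: le_mod_geq)
  qed (simp add: pres_cong.refl)
qed

private abbreviation ss :: "bool \<Rightarrow> dihedral_gen word" where
  "ss b \<equiv> (if b then [(Refl, True)] else [])"

private lemma letter_cong: "\<exists>m c. ss b @ [a] \<approx> rs m @ ss c"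
proof -
  obtain x d where a: "a = (x, d)" by force
  show ?thesis
  proof (cases x)
    case Refl
    have "ss b @ [(Refl, d)] \<approx> ss b @ [(Refl, True)]"
      by (intro pres_cong_append pres_cong.refl Refl_inv_cong)
    also have "\<dots> \<approx> rs 0 @ ss (\<not> b)"
      using relators_cong(2) by (auto simp: pres_cong.refl)
    finally show ?thesis using a Refl by blast
  next
    case Rot
    have "[(Rot, d)] \<approx> rs (if d then 1 else n - 1)"
      using Rot_inv_cong by (auto simp: pres_cong.refl)
    then obtain m where "[(Rot, d)] \<approx> rs m" by blast
    then have "ss b @ [(Rot, d)] \<approx> ss b @ rs m"
      by (intro pres_cong_append pres_cong.refl)
    also have "\<dots> \<approx> rs (if b then m * (n - 1) else m) @ ss b"
      using Refl_rs_cong[of m] by (auto simp: pres_cong.refl)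
    finally show ?thesis using a Rot by blast
  qed
qed

private lemma word_cong: "\<exists>k b. u \<approx> rs k @ ss b"
proof (induction u rule: rev_induct)
  case Nil
  have "[] \<approx> rs 0 @ ss False" by (simp add: pres_cong.refl)
  then show ?case by blast
next
  case (snoc a u)
  then obtain k b where kb: "u \<approx> rs k @ ss b" by blast
  obtain m c where mc: "ss b @ [a] \<approx> rs m @ ss c" using letter_cong by blast
  have "u @ [a] \<approx> (rs k @ ss b) @ [a]"
    by (intro pres_cong_append pres_cong.refl kb)
  also have "\<dots> = rs k @ (ss b @ [a])" by simp
  also have "\<dots> \<approx> rs k @ (rs m @ ss c)"
    by (intro pres_cong_append pres_cong.refl mc)
  also have "\<dots> = rs (k + m) @ ss c" by (simp add: replicate_add)
  finally show ?case by blast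
qed

lemma bij_betw_dihedral:
  "bij_betw (\<lambda>p. pres_class (dihedral_relators n) (dih_word p))
     ({0..<int n} \<times> UNIV) (carrier (dihedral n))"
  unfolding bij_betw_def
proof
  show "inj_on (\<lambda>p. pres_class (dihedral_relators n) (dih_word p)) ({0..<int n} \<times> UNIV)"
  proof (rule inj_onI)
    fix p q assume p: "p \<in> {0..<int n} \<times> (UNIV :: bool set)" and q: "q \<in> {0..<int n} \<times> (UNIV :: bool set)"
      and "pres_class (dihedral_relators n) (dih_word p) = pres_class (dihedral_relators n) (dih_word q)"
    then have "dih_nf n (dih_word p) = dih_nf n (dih_word q)"
      unfolding pres_class_eq_iff dih_nf_def using n by (intro fold_dih_step_cong) auto
    then show "p = q" using dih_nf_word[OF n] p q by simp
  qed
  have "pres_class (dihedral_relators n) u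
      \<in> (\<lambda>p. pres_class (dihedral_relators n) (dih_word p)) ` ({0..<int n} \<times> UNIV)" for u
  proof -
    obtain k b where kb: "u \<approx> rs k @ ss b" using word_cong by blast
    have "rs k @ ss b \<approx> rs (k mod n) @ ss b"
      by (intro pres_cong_append pres_cong.refl rs_mod_cong)
    from pres_cong.trans[OF kb this] have "u \<approx> dih_word (int (k mod n), b)"
      by (simp add: dih_word_def)
    moreover have "(int (k mod n), b) \<in> {0..<int n} \<times> UNIV" using n by simp
    ultimately show ?thesis
      unfolding image_iff pres_class_eq_iff by blast
  qed
  then show "(\<lambda>p. pres_class (dihedral_relators n) (dih_word p)) ` ({0..<int n} \<times> UNIV)
      = carrier (dihedral n)"
    unfolding dihedral_def carrier_presented_group by auto
qed

lemma order_dihedral: "order (dihedral n) = 2 * n"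
  using bij_betw_same_card[OF bij_betw_dihedral] by (simp add: order_def)

lemma generate_dihedral:
  "generate (dihedral n) {rotation n, reflection n} = carrier (dihedral n)"
proof
  interpret group "dihedral n" by (simp add: dihedral_def group_presented_group)
  have cl: "{rotation n, reflection n} \<subseteq> carrier (dihedral n)"
    by (simp add: rotation_def reflection_def dihedral_def carrier_presented_group)
  then show "generate (dihedral n) {rotation n, reflection n} \<subseteq> carrier (dihedral n)"
    by (rule generate_incl)
  have letter: "pres_class (dihedral_relators n) [(x, b)]
      \<in> generate (dihedral n) {rotation n, reflection n}" for x b
  proof -
    have "pres_class (dihedral_relators n) [(x, True)]
        \<in> generate (dihedral n) {rotation n, reflection n}" for x
      by (cases x) (auto simp: rotation_def reflection_def intro: generate.incl)
    from this[of x] generate_m_inv_closed[OF cl this[of x]] show ?thesis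
      by (cases b) (simp_all add: dihedral_def inv_presented_group word_inv_def)
  qed
  have "pres_class (dihedral_relators n) u
      \<in> generate (dihedral n) {rotation n, reflection n}" for u
  proof (induction u)
    case Nil
    show ?case
      using generate.one[of "dihedral n" "{rotation n, reflection n}"]
      by (simp add: dihedral_def one_presented_group)
  next
    case (Cons a u)
    obtain x b where a: "a = (x, b)" by force
    show ?case
      using generate.eng[OF letter[of x b] Cons.IH]
      by (simp add: dihedral_def mult_presented_group a)
  qed
  then show "carrier (dihedral n) \<subseteq> generate (dihedral n) {rotation n, reflection n}"
    by (auto simp: dihedral_def carrier_presented_group)
qed

end

lemma rav_game_dihedral:
  assumes "n \<ge> 2"
  shows "rav_game (dihedral n) {rotation n, reflection n}"
proof -
  have n: "n \<ge> 1" using assms by simp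
  have ne: "\<not> pres_cong (dihedral_relators n) [] [(x, True)]" for x
  proof
    assume "pres_cong (dihedral_relators n) [] [(x, True)]"
    from fold_dih_step_cong[OF n this, of "(0, False)"] assms show False
      by (cases x) auto
  qed
  interpret group "dihedral n" by (simp add: dihedral_def group_presented_group)
  show ?thesis
  proof
    show "finite (carrier (dihedral n))"
      using bij_betw_finite[OF bij_betw_dihedral[OF n]] by simp
    show "{rotation n, reflection n} \<subseteq> carrier (dihedral n)"
      by (simp add: rotation_def reflection_def dihedral_def carrier_presented_group)
    show "generate (dihedral n) {rotation n, reflection n} = carrier (dihedral n)"
      by (rule generate_dihedral[OF n])
    show "\<one>\<^bsub>dihedral n\<^esub> \<notin> {rotation n, reflection n}"
      using ne by (simp add: dihedral_def rotation_def reflection_def one_presented_group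
          pres_class_eq_iff)
  qed
qed

end

theory Submission
  imports Defs
begin

text \<open>
  The edges \<open>{g, g t}\<close> for an involution \<open>t \<in> S\<close> form a perfect matching of the Cayley graph, and
  Player 1 always moves along it by playing \<open>t\<close>. After each of these moves the visited vertices
  are a union of matching edges. Player 2 cannot play \<open>t\<close> right back, so unless Player 2 revisits a
  vertex, the partner of the vertex just reached is still unvisited. For the dihedral group, \<open>t\<close> is
  the reflection.
\<close>

lemma position_snocD:
  assumes "position G S (w @ [x])"
  shows "\<not> game_over G S w" "legal_move G S w x"
  using assms by (auto elim: position.cases)

lemma word_val_snoc: "word_val G (w @ [x]) = word_val G w \<otimes>\<^bsub>G\<^esub> x"
  by (simp add: word_val_def)

lemma (in rav_game) involution_winning_strategy:
  assumes t: "t \<in> S" and tt: "t \<otimes> t = \<one>"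
  shows "winning_strategy G S Player1 (\<lambda>_. t)"
  unfolding winning_strategy_def
proof (intro allI impI, elim conjE)
  fix w
  assume pos: "position G S w" and fol: "follows Player1 (\<lambda>_. t) w"
  have t_car: "t \<in> carrier G" and t_ne: "t \<noteq> \<one>"
    using t S_subset one_notin_S by auto
  have inv_t: "inv t = t"
    using tt t_car by (simp add: inv_equality)
  have nth_t: "w ! i = t" if "i < length w" "even i" for i
    using fol that by (simp add: follows_def to_move_def)
  have closed: "word_val G (take k w) \<in> carrier G" for k
    using position_closed[OF pos] by (intro word_val_closed) (auto dest: in_set_takeD)
  \<comment> \<open>Player 1 moves at even indices, so for even \<open>i\<close> the vertices at
    indices \<open>i\<close> and \<open>Suc i\<close> are the two ends of one matching edge.\<close>
  have pair: "word_val G (take (Suc i) w) = word_val G (take i w) \<otimes> t"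
    if "i < length w" "even i" for i
    using that nth_t by (simp add: take_Suc_conv_app_nth word_val_snoc)
  have cancel_tt: "g \<otimes> t \<otimes> t = g" if "g \<in> carrier G" for g
    using that t_car tt by (simp add: m_assoc)
  show "if game_over G S w then \<not> loses G Player1 w
        else to_move w = Player1 \<longrightarrow> legal_move G S w t"
  proof (cases "even (length w)")
    case True
    \<comment> \<open>Player 2's last move \<open>x\<close> answers a \<open>t\<close> of Player 1,
      so the rule against backtracking excludes \<open>x = t\<close>, and with it
      \<open>t = inv x\<close>.\<close>
    have "t \<noteq> inv (last w)" if "w \<noteq> []"
    proof
      assume t_last: "t = inv (last w)"
      obtain v x where w: "w = v @ [x]"
        using \<open>w \<noteq> []\<close> by (cases w rule: rev_cases) auto
      have "v \<noteq> []"
        using True by (auto simp: w)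
      then have "last v = t"
        using True nth_t[of "length v - 1"] by (simp add: w last_conv_nth nth_append)
      with \<open>v \<noteq> []\<close> have "x \<noteq> t"
        using position_snocD(2)[OF pos[unfolded w]] inv_t by (simp add: legal_move_def)
      moreover have "x \<in> carrier G"
        using position_closed[OF pos] by (simp add: w)
      ultimately show False
        using t_last inv_t by (metis inv_inv last_snoc w)
    qed
    then have "legal_move G S w t"
      using t by (simp add: legal_move_def)
    \<comment> \<open>Since \<open>t\<close> is legal, a finished game ended by a revisit here, and
      Player 2 made it.\<close>
    then show ?thesis
      using True by (auto simp: game_over_def loses_def to_move_def)
  next
    case False
    then obtain v x where w: "w = v @ [x]"
      by (cases w rule: rev_cases) auto
    have even_v: "even (length v)"
      using False by (simp add: w)
    have val_w: "word_val G w = word_val G v \<otimes> t"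
      using pair[of "length v"] even_v by (simp add: w)
    have v_car: "word_val G v \<in> carrier G"
      using closed[of "length v"] by (simp add: w)
    have fresh: "word_val G v \<noteq> word_val G (take k w)" if "k < length v" for k
      using position_snocD(1)[OF pos[unfolded w]] that
      by (auto simp: w game_over_def revisits_def)
    \<comment> \<open>This suffices: at odd length, a game that is over without a revisit has Player
      2 stuck.\<close>
    have "\<not> revisits G w"
    proof
      assume "revisits G w"
      then obtain k where k: "k \<le> length v"
        and eq: "word_val G v \<otimes> t = word_val G (take k w)"
        by (auto simp: revisits_def val_w) (auto simp: w less_Suc_eq_le)
      \<comment> \<open>The revisited vertex is the one just left, or the first or the second end of
        an earlier matching edge. In the last two cases the other end of that edge is
        \<open>word_val G v\<close>, against \<open>fresh\<close>.\<close>
      consider "k = length v" | "k < length v" "even k" | j where "k = Suc j" "even j"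
        using k by (cases k) (auto simp: le_less)
      then show False
      proof cases
        case 1
        then show False
          using eq v_car t_car t_ne by (simp add: w)
      next
        case 2
        then have "word_val G (take (Suc k) w) = word_val G v"
          using pair[of k] cancel_tt[OF v_car] eq by (simp add: w)
        \<comment> \<open>Both \<open>k\<close> and \<open>length v\<close> are even, so
          \<open>Suc k\<close> cannot be \<open>length v\<close>; \<open>fresh\<close> needs the
          strict bound.\<close>
        moreover have "Suc k < length v"
          using 2 even_v by (metis Suc_lessI even_Suc)
        ultimately show False
          using fresh by metis
      next
        case 3
        then have "word_val G (take j w) \<otimes> t = word_val G v \<otimes> t"
          using pair[of j] k eq by (simp add: w)
        then have "word_val G (take j w) = word_val G v"
          using closed v_car t_car by simp
        then show False
          using fresh[of j] 3 k by simp
      qed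
    qed
    then show ?thesis
      using False by (simp add: loses_def to_move_def)
  qed
qed

lemma reflection_mult_self: "reflection n \<otimes>\<^bsub>dihedral n\<^esub> reflection n = \<one>\<^bsub>dihedral n\<^esub>"
  using pres_cong.relator[of "[(Refl, True), (Refl, True)]" "dihedral_relators n" "[]" "[]"]
  by (simp add: reflection_def dihedral_def mult_presented_group one_presented_group
      pres_class_eq_iff dihedral_relators_def)

theorem theorem3p8:
  fixes n :: nat
  assumes "n \<ge> 3"
  shows "has_winning_strategy (dihedral n) {rotation n, reflection n} Player1"
proof -
  interpret rav_game "dihedral n" "{rotation n, reflection n}"
    using assms by (intro rav_game_dihedral) simp
  show ?thesis
    unfolding has_winning_strategy_def
    using involution_winning_strategy[OF _ reflection_mult_self] by blast
qed

end
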